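(* Let $n \in \mathbb{N}$ be a positive integer, and let $G = \langle a, b ; [a, w] \rangle$ be the one-relator group with generators $a, b$ and single defining relator $[a,w]$, where $w = [a,b]^n$. Then $G$ is residually solvable.
   Context: Commutators are $[u,v] = u^{-1}v^{-1}uv$. A group $G$ is residually solvable if for each $g \in G$ with $g \neq 1$ there exist a solvable group $S_g$ and an epimorphism $\phi : G \to S_g$ such that $\phi(g) \neq 1$. The notation $\langle X ; r \rangle$ denotes the group presented by generators $X$ and the defining relation $r = 1$. *)

theory Defs
  imports "HOL-Algebra.Solvable_Groups"
begin

section \<open>Words and group presentations\<close>

text \<open>A letter \<open>(x, True)\<close> stands for the generator \<open>x\<close> and \<open>(x, False)\<close> for its formal inverse.\<close>

type_synonym 'x word = "('x \<times> bool) list"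

definition gen_word :: "'x \<Rightarrow> 'x word"
  where "gen_word x = [(x, True)]"

definition word_inv :: "'x word \<Rightarrow> 'x word"
  where "word_inv u = rev (map (\<lambda>(x, s). (x, \<not> s)) u)"

definition word_pow :: "'x word \<Rightarrow> nat \<Rightarrow> 'x word"
  where "word_pow u n = concat (replicate n u)"

definition word_comm :: "'x word \<Rightarrow> 'x word \<Rightarrow> 'x word"
  where "word_comm u v = word_inv u @ word_inv v @ u @ v"

text \<open>Two words are equal in the group with relators \<open>R\<close> iff one is obtained from the other by
  finitely many insertions and deletions of trivial relators and of elements of \<open>R\<close>.\<close>

inductive word_eq :: "'x word set \<Rightarrow> 'x word \<Rightarrow> 'x word \<Rightarrow> bool" for R where
  refl: "word_eq R u u"
| sym: "word_eq R u v \<Longrightarrow> word_eq R v u"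
| trans: "word_eq R u v \<Longrightarrow> word_eq R v w \<Longrightarrow> word_eq R u w"
| cancel: "word_eq R (u @ [(x, s), (x, \<not> s)] @ v) (u @ v)"
| relator: "r \<in> R \<Longrightarrow> word_eq R (u @ r @ v) (u @ v)"

definition word_class :: "'x word set \<Rightarrow> 'x word \<Rightarrow> 'x word set"
  where "word_class R u = {v. word_eq R u v}"

text \<open>The set of generators is the whole type \<open>'x\<close>.\<close>

definition presented_group :: "'x word set \<Rightarrow> 'x word set monoid"
  where "presented_group R =
    \<lparr>carrier = range (word_class R),
     monoid.mult = (\<lambda>A B. {w. \<exists>u\<in>A. \<exists>v\<in>B. word_eq R (u @ v) w}),
     one = word_class R []\<rparr>"

lemma word_eq_append_left: "word_eq R u v \<Longrightarrow> word_eq R (p @ u) (p @ v)"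
proof (induction rule: word_eq.induct)
  case (cancel u x s v)
  show ?case using word_eq.cancel[of R "p @ u" x s v] by simp
next
  case (relator r u v)
  show ?case using word_eq.relator[OF relator, of "p @ u" v] by simp
qed (blast intro: word_eq.refl word_eq.sym word_eq.trans)+

lemma word_eq_append_right: "word_eq R u v \<Longrightarrow> word_eq R (u @ p) (v @ p)"
proof (induction rule: word_eq.induct)
  case (cancel u x s v)
  show ?case using word_eq.cancel[of R u x s "v @ p"] by simp
next
  case (relator r u v)
  show ?case using word_eq.relator[OF relator, of u "v @ p"] by simp
qed (blast intro: word_eq.refl word_eq.sym word_eq.trans)+

lemma word_eq_append:
  "word_eq R u u' \<Longrightarrow> word_eq R v v' \<Longrightarrow> word_eq R (u @ v) (u' @ v')"
  by (blast intro: word_eq.trans word_eq_append_left word_eq_append_right)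

lemma word_class_eq_iff: "word_class R u = word_class R v \<longleftrightarrow> word_eq R u v"
  unfolding word_class_def set_eq_iff mem_Collect_eq
  by (blast intro: word_eq.refl word_eq.sym word_eq.trans)

lemma carrier_presented_group: "carrier (presented_group R) = range (word_class R)"
  by (simp add: presented_group_def)

lemma one_presented_group: "\<one>\<^bsub>presented_group R\<^esub> = word_class R []"
  by (simp add: presented_group_def)

lemma mult_presented_group:
  "word_class R u \<otimes>\<^bsub>presented_group R\<^esub> word_class R v = word_class R (u @ v)"
  unfolding presented_group_def word_class_def
  by (auto intro: word_eq.refl word_eq.trans word_eq_append)

lemma word_inv_Nil: "word_inv [] = []"
  and word_inv_Cons: "word_inv ((x, s) # u) = word_inv u @ [(x, \<not> s)]"
  by (simp_all add: word_inv_def)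

lemma word_eq_inv_left: "word_eq R (word_inv u @ u) []"
proof (induction u)
  case Nil
  show ?case by (simp add: word_inv_Nil word_eq.refl)
next
  case (Cons l u)
  obtain x s where l: "l = (x, s)" by fastforce
  have "word_eq R (word_inv (l # u) @ l # u) (word_inv u @ u)"
    using word_eq.cancel[of R "word_inv u" x "\<not> s" u] by (simp add: l word_inv_Cons)
  then show ?case using Cons.IH by (rule word_eq.trans)
qed

lemma group_presented_group: "group (presented_group R)"
proof (rule groupI)
  fix A assume "A \<in> carrier (presented_group R)"
  then obtain u where "A = word_class R u" by (auto simp: carrier_presented_group)
  then have "word_class R (word_inv u) \<otimes>\<^bsub>presented_group R\<^esub> A = \<one>\<^bsub>presented_group R\<^esub>"
    by (simp add: mult_presented_group one_presented_group word_class_eq_iff word_eq_inv_left)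
  then show "\<exists>B\<in>carrier (presented_group R). B \<otimes>\<^bsub>presented_group R\<^esub> A = \<one>\<^bsub>presented_group R\<^esub>"
    by (auto simp: carrier_presented_group)
qed (auto simp: carrier_presented_group one_presented_group mult_presented_group)

lemma inv_presented_group:
  "inv\<^bsub>presented_group R\<^esub> (word_class R u) = word_class R (word_inv u)"
  by (rule group.inv_equality[OF group_presented_group])
    (auto simp: carrier_presented_group one_presented_group mult_presented_group
      word_class_eq_iff word_eq_inv_left)

primrec word_eval :: "('g, 'm) monoid_scheme \<Rightarrow> ('x \<Rightarrow> 'g) \<Rightarrow> 'x word \<Rightarrow> 'g" where
  "word_eval H f [] = \<one>\<^bsub>H\<^esub>"
| "word_eval H f (l # u) =
     (if snd l then f (fst l) else inv\<^bsub>H\<^esub> f (fst l)) \<otimes>\<^bsub>H\<^esub> word_eval H f u"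

context group
begin

lemma word_eval_closed: "range f \<subseteq> carrier G \<Longrightarrow> word_eval G f u \<in> carrier G"
  by (induction u) auto

lemma word_eval_append:
  assumes "range f \<subseteq> carrier G"
  shows "word_eval G f (u @ v) = word_eval G f u \<otimes> word_eval G f v"
proof (induction u)
  case Nil
  show ?case using word_eval_closed[OF assms] by simp
next
  case (Cons l u)
  have "f x \<in> carrier G" for x using assms by auto
  then show ?case using word_eval_closed[OF assms] Cons by (auto simp: m_assoc)
qed

lemma word_eval_cong:
  assumes f: "range f \<subseteq> carrier G" and R: "\<And>r. r \<in> R \<Longrightarrow> word_eval G f r = \<one>"
    and eq: "word_eq R u v"
  shows "word_eval G f u = word_eval G f v"
  using eq
proof induction
  case (cancel u x s v)
  have "f x \<in> carrier G" using f by auto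
  then have "word_eval G f [(x, s), (x, \<not> s)] = \<one>" by (cases s) auto
  then show ?case by (simp only: word_eval_append[OF f] word_eval_closed[OF f] l_one)
qed (simp_all add: word_eval_append[OF f] word_eval_closed[OF f] R)

lemma presented_group_universal:
  assumes f: "range f \<subseteq> carrier G" and R: "\<And>r. r \<in> R \<Longrightarrow> word_eval G f r = \<one>"
  shows "\<exists>h \<in> hom (presented_group R) G. \<forall>u. h (word_class R u) = word_eval G f u"
proof -
  define h where "h A = word_eval G f (SOME u. A = word_class R u)" for A
  have h: "h (word_class R u) = word_eval G f u" for u
  proof -
    have "word_class R u = word_class R (SOME v. word_class R u = word_class R v)"
      by (rule someI) (rule HOL.refl)
    then have "word_eq R u (SOME v. word_class R u = word_class R v)"
      by (simp only: word_class_eq_iff)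
    from word_eval_cong[OF f R this] show ?thesis by (simp add: h_def)
  qed
  have "h \<in> hom (presented_group R) G"
    by (rule homI) (auto simp: carrier_presented_group mult_presented_group h
        word_eval_closed[OF f] word_eval_append[OF f])
  with h show ?thesis by blast
qed

end


section \<open>Residual solvability\<close>

text \<open>The type of \<open>S\<close> is no restriction: every epimorphic image of \<open>G\<close> is isomorphic to a quotient
  of \<open>G\<close>, whose elements are cosets; see \<open>residually_solvableI\<close>.\<close>

definition residually_solvable :: "('a, 'm) monoid_scheme \<Rightarrow> bool"
  where "residually_solvable G \<longleftrightarrow>
    group G \<and>
    (\<forall>g \<in> carrier G. g \<noteq> \<one>\<^bsub>G\<^esub> \<longrightarrow>
      (\<exists>(S :: 'a set monoid) \<phi>.
        group S \<and> solvable S \<and> \<phi> \<in> epi G S \<and> \<phi> g \<noteq> \<one>\<^bsub>S\<^esub>))"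

lemma solvable_quotient_transfer:
  fixes G :: "('a, 'm) monoid_scheme" and S :: "('b, 'n) monoid_scheme"
  assumes "group G" "group S" "solvable S" "\<phi> \<in> epi G S" "g \<in> carrier G" "\<phi> g \<noteq> \<one>\<^bsub>S\<^esub>"
  shows "\<exists>(S' :: 'a set monoid) \<phi>'.
    group S' \<and> solvable S' \<and> \<phi>' \<in> epi G S' \<and> \<phi>' g \<noteq> \<one>\<^bsub>S'\<^esub>"
proof -
  interpret group_hom G S \<phi>
    using assms by (simp add: group_hom_def group_hom_axioms_def epi_def)
  let ?K = "kernel G S \<phi>"
  let ?Q = "G Mod ?K"
  let ?q = "(#>\<^bsub>G\<^esub>) ?K"
  have surj: "\<phi> ` carrier G = carrier S" using assms by (simp add: epi_def)
  have grp: "group ?Q" by (rule normal.factorgroup_is_group[OF normal_kernel])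
  have iso: "(\<lambda>C. the_elem (\<phi> ` C)) \<in> iso ?Q S" by (rule FactGroup_iso_set[OF surj])
  interpret Q: group_hom ?Q S "\<lambda>C. the_elem (\<phi> ` C)"
    using iso grp assms(2) by (simp add: group_hom_def group_hom_axioms_def iso_def)
  have "solvable ?Q"
    by (rule Q.inj_hom_imp_solvable) (use iso assms(3) in \<open>auto simp: iso_def bij_betw_def\<close>)
  moreover have "?q \<in> epi G ?Q"
    using normal.r_coset_hom_Mod[OF normal_kernel]
    by (auto simp: epi_def FactGroup_def RCOSETS_def)
  moreover have "?q g \<noteq> \<one>\<^bsub>?Q\<^esub>"
  proof
    assume "?q g = \<one>\<^bsub>?Q\<^esub>"
    then have "g \<in> ?K"
      using G.rcos_self[OF assms(5) subgroup_kernel] by (simp add: FactGroup_def)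
    then show False using assms(6) by (simp add: kernel_def)
  qed
  ultimately show ?thesis using grp by blast
qed

lemma residually_solvableI:
  fixes G :: "('a, 'm) monoid_scheme"
  assumes "group G"
    and "\<And>g. g \<in> carrier G \<Longrightarrow> g \<noteq> \<one>\<^bsub>G\<^esub> \<Longrightarrow>
      \<exists>(S :: 'b monoid) \<phi>. group S \<and> solvable S \<and> \<phi> \<in> epi G S \<and> \<phi> g \<noteq> \<one>\<^bsub>S\<^esub>"
  shows "residually_solvable G"
  unfolding residually_solvable_def
  using assms solvable_quotient_transfer[OF assms(1)] by meson


section \<open>The one-relator groups\<close>

datatype generator = Gen_a | Gen_b

abbreviation word_a :: "generator word"
  where "word_a \<equiv> gen_word Gen_a"

abbreviation word_b :: "generator word"
  where "word_b \<equiv> gen_word Gen_b"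

end

theory Submission
  imports Defs
begin

text \<open>
  Write \<open>c = [a, b]\<close>, so that the relation says that \<open>a\<close> commutes with \<open>c ^ n\<close>. Two infinite
  cyclic layers can be peeled off the group. Killing \<open>b\<close> leaves \<open>\<langle>a\<rangle>\<close>, and the normal
  closure \<open>M\<close> of \<open>b\<close> is generated by the conjugates \<open>b\<^sub>i = a ^ -i b a ^ i\<close>. The conjugates
  \<open>c\<^sub>i = a ^ -i c a ^ i\<close> satisfy \<open>b\<^sub>i\<^sub>+\<^sub>1 c\<^sub>i = b\<^sub>i\<close>, so \<open>b\<^sub>0\<close> and all the \<open>c\<^sub>i\<close> generate \<open>M\<close>; the
  relation becomes \<open>c\<^sub>i ^ n = c\<^sub>0 ^ n\<close>. So \<open>M\<close> is the free product of \<open>\<langle>b\<^sub>0\<rangle>\<close> with the infinite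
  cyclic groups \<open>\<langle>c\<^sub>i\<rangle>\<close> amalgamated along the \<open>n\<close>-th powers of their generators.
  Sending every \<open>c\<^sub>i\<close> to \<open>1\<close> and \<open>b\<^sub>0\<close> to \<open>0\<close> maps \<open>M\<close> onto the integers, split by \<open>c\<close>. The kernel is free on the elements
  \<open>c ^ -j b c ^ j\<close> for all \<open>j\<close>, and \<open>c ^ -j c\<^sub>i ^ j\<close> for \<open>i \<noteq> 0\<close> and \<open>0 < j < n\<close>. Thus the group is
  obtained from a free group by two successive semidirect products with the integers, and free groups
  are residually solvable. A homomorphism from the free kernel to a solvable group need not extend
  to the whole group, but it is a component of the restriction of a homomorphism from the whole group to
  an iterated wreath product with the integers, which is again solvable.

  The wreath products are realized as permutations that move each integer coordinate of
  a state by an amount depending on the earlier coordinates only; with finitely many moving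
  coordinates they form a solvable group (\<open>solvable_triangular_group\<close>). A state \<open>(i, j, v)\<close> has one
  coordinate for each of the two infinite cyclic layers, and a sequence \<open>v\<close> on which the free kernel
  acts. The lemma \<open>action_on_states\<close> shows that any assignment of triangular permutations of the
  sequences to the basis comes from an action of the group on the states.

  On the other side, \<open>normal_forms_mult_left\<close> shows that every element is \<open>a ^ p c ^ q x\<close>, where \<open>x\<close> is
  the value of a reduced word in the basis. The basis is sent to elementary unitriangular integral
  matrices chosen along this word, as in Magnus' proof that free groups are residually nilpotent:
  then the word moves the first unit vector unless it is empty (\<open>transvections_detect\<close>).
  The element maps \<open>(0, 0, v)\<close> to \<open>(p, q, x v)\<close> by \<open>hom_normal_form\<close>, so it acts nontrivially unless
  \<open>p = q = 0\<close> and the word is empty.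
\<close>

section \<open>Triangular permutations form solvable groups\<close>

text \<open>The parameter \<open>\<pi>\<close> lists integer coordinates of a state. When these coordinates are independent and
  determine the state, the permutations below form the iterated wreath product of \<open>m\<close> copies of
  the integers: coordinate \<open>k\<close> is translated by an amount which only
  the coordinates before \<open>k\<close> determine.\<close>

definition triangular :: "(nat \<Rightarrow> 's \<Rightarrow> int) \<Rightarrow> nat \<Rightarrow> ('s \<Rightarrow> 's) set"
  where "triangular \<pi> m = {f. bij f \<and>
    (\<forall>k s t. (\<forall>j<k. \<pi> j s = \<pi> j t) \<longrightarrow> \<pi> k (f s) - \<pi> k s = \<pi> k (f t) - \<pi> k t) \<and>
    (\<forall>k\<ge>m. \<forall>s. \<pi> k (f s) = \<pi> k s)}"

definition triangular_group :: "(nat \<Rightarrow> 's \<Rightarrow> int) \<Rightarrow> nat \<Rightarrow> ('s \<Rightarrow> 's) monoid"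
  where "triangular_group \<pi> m = \<lparr>carrier = triangular \<pi> m, monoid.mult = (\<circ>), one = id\<rparr>"

lemma triangular_group_simps [simp]:
  "carrier (triangular_group \<pi> m) = triangular \<pi> m"
  "x \<otimes>\<^bsub>triangular_group \<pi> m\<^esub> y = x \<circ> y"
  "\<one>\<^bsub>triangular_group \<pi> m\<^esub> = id"
  by (simp_all add: triangular_group_def)

lemma triangular_bij: "f \<in> triangular \<pi> m \<Longrightarrow> bij f"
  and triangular_displacement:
    "f \<in> triangular \<pi> m \<Longrightarrow> (\<And>j. j < k \<Longrightarrow> \<pi> j s = \<pi> j t) \<Longrightarrow>
      \<pi> k (f s) - \<pi> k s = \<pi> k (f t) - \<pi> k t"
  and triangular_fixes: "f \<in> triangular \<pi> m \<Longrightarrow> m \<le> k \<Longrightarrow> \<pi> k (f s) = \<pi> k s"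
  by (simp_all add: triangular_def)

lemma triangularI:
  assumes "bij f"
    and "\<And>k s t. (\<And>j. j < k \<Longrightarrow> \<pi> j s = \<pi> j t) \<Longrightarrow> \<pi> k (f s) - \<pi> k s = \<pi> k (f t) - \<pi> k t"
    and "\<And>k s. m \<le> k \<Longrightarrow> \<pi> k (f s) = \<pi> k s"
  shows "f \<in> triangular \<pi> m"
  unfolding triangular_def using assms by blast

text \<open>Agreement on an initial segment of coordinates is preserved in both directions, because equal
  earlier coordinates force equal displacements. This makes compositions and inverses triangular.\<close>

lemma triangular_agree:
  assumes f: "f \<in> triangular \<pi> m"
  shows "(\<forall>j<k. \<pi> j (f s) = \<pi> j (f t)) \<longleftrightarrow> (\<forall>j<k. \<pi> j s = \<pi> j t)"
proof (induction k)
  case (Suc k)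
  show ?case
  proof (cases "\<forall>j<k. \<pi> j s = \<pi> j t")
    case True
    then have "\<pi> k (f s) - \<pi> k s = \<pi> k (f t) - \<pi> k t"
      using triangular_displacement[OF f] by blast
    then show ?thesis using Suc by (auto simp: less_Suc_eq)
  next
    case False
    then show ?thesis using Suc by (auto simp: less_Suc_eq)
  qed
qed simp

lemma triangular_comp:
  assumes f: "f \<in> triangular \<pi> m" and g: "g \<in> triangular \<pi> m"
  shows "f \<circ> g \<in> triangular \<pi> m"
proof (rule triangularI)
  show "bij (f \<circ> g)" using f g by (blast intro: bij_comp triangular_bij)
next
  fix k s t assume eq: "\<And>j. j < k \<Longrightarrow> \<pi> j s = \<pi> j t"
  then have "\<pi> j (g s) = \<pi> j (g t)" if "j < k" for j
    using triangular_agree[OF g, of k s t] that by blast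
  then have "\<pi> k (f (g s)) - \<pi> k (g s) = \<pi> k (f (g t)) - \<pi> k (g t)"
    by (rule triangular_displacement[OF f])
  then show "\<pi> k ((f \<circ> g) s) - \<pi> k s = \<pi> k ((f \<circ> g) t) - \<pi> k t"
    using triangular_displacement[OF g, of k s t, OF eq] by simp
next
  fix k s assume "m \<le> k"
  then show "\<pi> k ((f \<circ> g) s) = \<pi> k s"
    using f g by (simp add: triangular_fixes)
qed

lemma triangular_inv:
  assumes f: "f \<in> triangular \<pi> m"
  shows "inv_into UNIV f \<in> triangular \<pi> m"
proof (rule triangularI)
  have surj: "f (inv_into UNIV f s) = s" for s
    by (rule surj_f_inv_f[OF bij_is_surj[OF triangular_bij[OF f]]])
  show "bij (inv_into UNIV f)" using f by (blast intro: bij_imp_bij_inv triangular_bij)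
  show "\<pi> k (inv_into UNIV f s) = \<pi> k s" if "m \<le> k" for k s
    using triangular_fixes[OF f that, of "inv_into UNIV f s"] by (simp add: surj)
  fix k s t assume "\<And>j. j < k \<Longrightarrow> \<pi> j s = \<pi> j t"
  then have "\<pi> j (inv_into UNIV f s) = \<pi> j (inv_into UNIV f t)" if "j < k" for j
    using triangular_agree[OF f, of k "inv_into UNIV f s" "inv_into UNIV f t"] that by (simp add: surj)
  then have "\<pi> k s - \<pi> k (inv_into UNIV f s) = \<pi> k t - \<pi> k (inv_into UNIV f t)"
    using triangular_displacement[OF f, of k "inv_into UNIV f s" "inv_into UNIV f t"] by (simp add: surj)
  then show "\<pi> k (inv_into UNIV f s) - \<pi> k s = \<pi> k (inv_into UNIV f t) - \<pi> k t" by simp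
qed

lemma id_triangular: "id \<in> triangular \<pi> m"
  by (rule triangularI) auto

lemma group_triangular_group: "group (triangular_group \<pi> m)"
proof (rule groupI)
  fix f assume f: "f \<in> carrier (triangular_group \<pi> m)"
  then have "inv_into UNIV f \<circ> f = id"
    by (simp add: bij_is_inj triangular_bij)
  then show "\<exists>g\<in>carrier (triangular_group \<pi> m). g \<otimes>\<^bsub>triangular_group \<pi> m\<^esub> f = \<one>\<^bsub>triangular_group \<pi> m\<^esub>"
    using f triangular_inv by auto
qed (auto simp: triangular_comp id_triangular comp_assoc)

lemma inv_triangular_group:
  assumes "f \<in> triangular \<pi> m"
  shows "inv\<^bsub>triangular_group \<pi> m\<^esub> f = inv_into UNIV f"
  using assms
  by (intro group.inv_equality[OF group_triangular_group])
    (simp_all add: triangular_inv bij_is_inj triangular_bij)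

lemma subgroup_fixing_coordinates:
  "subgroup {f \<in> triangular \<pi> m. \<forall>j<k. \<forall>s. \<pi> j (f s) = \<pi> j s} (triangular_group \<pi> m)"
proof (rule group.subgroupI[OF group_triangular_group])
  show "{f \<in> triangular \<pi> m. \<forall>j<k. \<forall>s. \<pi> j (f s) = \<pi> j s} \<noteq> {}"
    using id_triangular[of \<pi> m] by auto
next
  fix f assume f: "f \<in> {f \<in> triangular \<pi> m. \<forall>j<k. \<forall>s. \<pi> j (f s) = \<pi> j s}"
  then have ft: "f \<in> triangular \<pi> m" by simp
  have surj: "f (inv_into UNIV f s) = s" for s
    by (rule surj_f_inv_f[OF bij_is_surj[OF triangular_bij[OF ft]]])
  have "\<pi> j (inv_into UNIV f s) = \<pi> j s" if "j < k" for j s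
  proof -
    have "\<pi> j (f (inv_into UNIV f s)) = \<pi> j (inv_into UNIV f s)"
      using f that by blast
    then show ?thesis by (simp only: surj)
  qed
  then show "inv\<^bsub>triangular_group \<pi> m\<^esub> f \<in> {f \<in> triangular \<pi> m. \<forall>j<k. \<forall>s. \<pi> j (f s) = \<pi> j s}"
    using f by (simp add: inv_triangular_group triangular_inv)
qed (auto simp: triangular_comp)

text \<open>If two permutations fix the coordinates before \<open>k\<close>, then each of them translates coordinate
  \<open>k\<close> by an amount that the other one does not change. Translations commute, so the commutator fixes
  coordinate \<open>k\<close> as well, and each derivation step gains one coordinate.\<close>

lemma derived_series_triangular_group:
  "(derived (triangular_group \<pi> m) ^^ k) (triangular \<pi> m)
    \<subseteq> {f \<in> triangular \<pi> m. \<forall>j<k. \<forall>s. \<pi> j (f s) = \<pi> j s}"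
proof (induction k)
  case (Suc k)
  let ?T = "triangular_group \<pi> m"
  define K where "K = (\<lambda>k. {f \<in> triangular \<pi> m. \<forall>j<k. \<forall>s. \<pi> j (f s) = \<pi> j s})"
  have commutes: "\<pi> j (f (g s)) = \<pi> j (g (f s))"
    if f: "f \<in> K k" and g: "g \<in> K k" and j: "j < Suc k" for f g j s
  proof (cases "j < k")
    case True
    then show ?thesis using f g by (simp add: K_def)
  next
    case False
    with j have "j = k" by simp
    have ft: "f \<in> triangular \<pi> m" and gt: "g \<in> triangular \<pi> m"
      using f g by (simp_all add: K_def)
    have "\<pi> k (f (g s)) - \<pi> k (g s) = \<pi> k (f s) - \<pi> k s"
      by (rule triangular_displacement[OF ft]) (use g in \<open>simp add: K_def\<close>)
    moreover have "\<pi> k (g (f s)) - \<pi> k (f s) = \<pi> k (g s) - \<pi> k s"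
      by (rule triangular_displacement[OF gt]) (use f in \<open>simp add: K_def\<close>)
    ultimately show ?thesis using \<open>j = k\<close> by simp
  qed
  have "derived_set ?T (K k) \<subseteq> K (Suc k)"
  proof clarsimp
    fix f g assume f: "f \<in> K k" and g: "g \<in> K k"
    have ft: "f \<in> triangular \<pi> m" and gt: "g \<in> triangular \<pi> m"
      using f g by (simp_all add: K_def)
    have "g (f (inv_into UNIV f (inv_into UNIV g s))) = s" for s
      using ft gt by (simp add: surj_f_inv_f[OF bij_is_surj[OF triangular_bij]])
    then have "\<pi> j (f (g (inv_into UNIV f (inv_into UNIV g s)))) = \<pi> j s" if "j < Suc k" for j s
      using commutes[OF f g that, of "inv_into UNIV f (inv_into UNIV g s)"] by simp
    then show "f \<circ> g \<circ> inv\<^bsub>?T\<^esub> f \<circ> inv\<^bsub>?T\<^esub> g \<in> K (Suc k)"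
      using ft gt by (simp add: K_def inv_triangular_group triangular_comp triangular_inv)
  qed
  then have "derived ?T (K k) \<subseteq> K (Suc k)"
    unfolding derived_def
    using group.generate_subgroup_incl[OF group_triangular_group]
      subgroup_fixing_coordinates[of \<pi> m "Suc k"] by (simp add: K_def)
  moreover have "derived ?T ((derived ?T ^^ k) (triangular \<pi> m)) \<subseteq> derived ?T (K k)"
    using Suc.IH by (intro group.mono_derived[OF group_triangular_group]) (simp add: K_def)
  ultimately have "(derived ?T ^^ Suc k) (triangular \<pi> m) \<subseteq> K (Suc k)"
    unfolding funpow.simps comp_apply by (rule subset_trans[rotated])
  then show ?case by (simp only: K_def)
qed simp

lemma solvable_triangular_group:
  assumes inj: "\<And>s t. (\<And>k. \<pi> k s = \<pi> k t) \<Longrightarrow> s = t"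
  shows "solvable (triangular_group \<pi> m)"
proof -
  let ?D = "(derived (triangular_group \<pi> m) ^^ m) (triangular \<pi> m)"
  have "f = id" if "f \<in> ?D" for f
  proof
    fix s
    have f: "f \<in> triangular \<pi> m" and "\<And>j. j < m \<Longrightarrow> \<pi> j (f s) = \<pi> j s"
      using that derived_series_triangular_group[of m \<pi> m] by auto
    then have "\<pi> k (f s) = \<pi> k s" for k
      using triangular_fixes[OF f, of k s] by (cases "k < m") auto
    then show "f s = id s" by (simp add: inj)
  qed
  moreover have "subgroup ?D (triangular_group \<pi> m)"
    using group.exp_of_derived_is_subgroup[OF group_triangular_group
        group.subgroup_self[OF group_triangular_group]] by simp
  then have "id \<in> ?D"
    using subgroup.one_closed[of ?D "triangular_group \<pi> m"] by simp
  ultimately have "?D = {id}" by blast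
  then show ?thesis
    unfolding group.solvable_iff_trivial_derived_seq[OF group_triangular_group]
    by (auto simp: fun_eq_iff)
qed

text \<open>Surjectivity is free: replace the solvable group by the image.\<close>

lemma residually_solvable_by_homs:
  fixes G :: "('a, 'm) monoid_scheme"
  assumes G: "group G"
    and homs: "\<And>g. g \<in> carrier G \<Longrightarrow> g \<noteq> \<one>\<^bsub>G\<^esub> \<Longrightarrow>
      \<exists>(S :: 'b monoid) \<phi>. group S \<and> solvable S \<and> \<phi> \<in> hom G S \<and> \<phi> g \<noteq> \<one>\<^bsub>S\<^esub>"
  shows "residually_solvable G"
proof (rule residually_solvableI[OF G])
  fix g assume "g \<in> carrier G" "g \<noteq> \<one>\<^bsub>G\<^esub>"
  then obtain S :: "'b monoid" and \<phi>
    where S: "group S" "solvable S" and \<phi>: "\<phi> \<in> hom G S" "\<phi> g \<noteq> \<one>\<^bsub>S\<^esub>"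
    using homs by blast
  interpret \<phi>: group_hom G S \<phi>
    using G S \<phi> by (simp add: group_hom_def group_hom_axioms_def)
  let ?I = "S\<lparr>carrier := \<phi> ` carrier G\<rparr>"
  have I: "group ?I"
    by (rule S(1)[THEN group.subgroup_imp_group, OF \<phi>.img_is_subgroup])
  have "group_hom ?I S id"
    using I S \<phi>.img_is_subgroup[THEN subgroup.subset]
    by (auto simp: group_hom_def group_hom_axioms_def hom_def)
  then have "solvable ?I"
    using group_hom.inj_hom_imp_solvable[of ?I S id] S(2) by simp
  moreover have "\<phi> \<in> epi G ?I"
    using \<phi>(1) by (auto simp: epi_def hom_def)
  ultimately show "\<exists>(S :: 'b monoid) \<phi>. group S \<and> solvable S \<and> \<phi> \<in> epi G S \<and> \<phi> g \<noteq> \<one>\<^bsub>S\<^esub>"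
    using I \<phi>(2) by (intro exI[of _ ?I] exI[of _ \<phi>]) simp
qed

section \<open>Action on states from an action of the basis\<close>

text \<open>Integer powers of a triangular permutation are computed by following a two-sided orbit; this
  treats negative exponents without describing inverses.\<close>

lemma triangular_pow_orbit:
  fixes s :: "int \<Rightarrow> 's" and e i :: int
  assumes f: "f \<in> triangular \<pi> m" and step: "\<And>i. f (s i) = s (i + 1)"
  shows "(f [^]\<^bsub>triangular_group \<pi> m\<^esub> e) (s i) = s (i + e)"
proof -
  interpret T: group "triangular_group \<pi> m" by (rule group_triangular_group)
  have pow: "(f [^]\<^bsub>triangular_group \<pi> m\<^esub> k) (s i) = s (i + int k)" for k :: nat and i
  proof (induction k arbitrary: i)
    case (Suc k)
    then show ?case by (simp add: step add.commute add.left_commute)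
  qed simp
  show ?thesis
  proof (cases e)
    case (nonneg k)
    then show ?thesis using pow[of k i] by (simp only: int_pow_int)
  next
    case (neg k)
    let ?g = "f [^]\<^bsub>triangular_group \<pi> m\<^esub> Suc k"
    have g: "?g \<in> triangular \<pi> m" using T.nat_pow_closed[of f "Suc k"] f by simp
    have "?g (s (i + e)) = s i" using pow[of "Suc k" "i + e"] neg by simp
    then have "inv_into UNIV ?g (s i) = s (i + e)"
      by (metis inv_f_f bij_is_inj triangular_bij g)
    then show ?thesis
      using T.int_pow_neg_int[of f "Suc k"] f by (simp only: neg inv_triangular_group[OF g] triangular_group_simps)
  qed
qed

text \<open>Two-sided recursion is possible in a group since the step \<open>x \<mapsto> x d\<^sub>i\<close> can be undone.\<close>

lemma (in group) int_recursion:
  fixes d :: "int \<Rightarrow> 'a"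
  assumes d: "\<And>i. d i \<in> carrier G" and y: "y \<in> carrier G"
  obtains u :: "int \<Rightarrow> 'a"
  where "\<And>i. u i \<in> carrier G" "u 0 = y" "\<And>i. u (i + 1) = u i \<otimes> d i"
proof -
  define p where "p = rec_nat y (\<lambda>k x. x \<otimes> d (int k))"
  define q where "q = rec_nat y (\<lambda>k x. x \<otimes> inv d (- int k - 1))"
  define u where "u i = (if i \<ge> 0 then p (nat i) else q (nat (- i)))" for i :: int
  have p: "p k \<in> carrier G" for k by (induction k) (simp_all add: p_def y d)
  have q: "q k \<in> carrier G" for k by (induction k) (simp_all add: q_def y d)
  have "u (i + 1) = u i \<otimes> d i" for i
  proof (cases "i \<ge> 0")
    case True
    then have "nat (i + 1) = Suc (nat i)" by simp
    then show ?thesis using True by (simp add: u_def p_def)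
  next
    case False
    then have *: "nat (- i) = Suc (nat (- i - 1))" by simp
    have "q (nat (- i)) = q (nat (- i - 1)) \<otimes> inv d i"
      unfolding * using False by (simp add: q_def)
    then have "q (nat (- i)) \<otimes> d i = q (nat (- i - 1))"
      using q[of "nat (- i - 1)"] d[of i] by (simp add: m_assoc)
    moreover have "u (i + 1) = q (nat (- i - 1))"
    proof (cases "i = - 1")
      case True
      then show ?thesis by (simp add: u_def p_def q_def)
    next
      case neg: False
      then have "\<not> 0 \<le> i + 1" and eq: "- (i + 1) = - i - 1" using False by auto
      then show ?thesis by (simp only: u_def if_False eq)
    qed
    ultimately show ?thesis using False by (simp add: u_def)
  qed
  moreover have "u i \<in> carrier G" for i by (simp add: u_def p q)
  moreover have "u 0 = y" by (simp add: u_def p_def)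
  ultimately show thesis using that by blast
qed

definition commutator :: "('a, 'm) monoid_scheme \<Rightarrow> 'a \<Rightarrow> 'a \<Rightarrow> 'a"
  where "commutator H x y = inv\<^bsub>H\<^esub> x \<otimes>\<^bsub>H\<^esub> (inv\<^bsub>H\<^esub> y \<otimes>\<^bsub>H\<^esub> (x \<otimes>\<^bsub>H\<^esub> y))"

lemma (in group) commutator_closed [simp]:
  "x \<in> carrier G \<Longrightarrow> y \<in> carrier G \<Longrightarrow> commutator G x y \<in> carrier G"
  by (simp add: commutator_def)

type_synonym state = "int \<times> int \<times> (nat \<Rightarrow> int)"

definition state_coord :: "nat \<Rightarrow> state \<Rightarrow> int"
  where "state_coord k = (\<lambda>(i, j, v). case k of 0 \<Rightarrow> i | Suc k' \<Rightarrow> (case k' of 0 \<Rightarrow> j | Suc l \<Rightarrow> v l))"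

lemma state_coord_simps [simp]:
  "state_coord 0 (i, j, v) = i"
  "state_coord (Suc 0) (i, j, v) = j"
  "state_coord (Suc (Suc l)) (i, j, v) = v l"
  by (simp_all add: state_coord_def)

lemma state_coord_inj: "(\<And>k. state_coord k s = state_coord k t) \<Longrightarrow> s = t"
proof -
  assume eq: "\<And>k. state_coord k s = state_coord k t"
  obtain i j v i' j' v' where s: "s = (i, j, v)" and t: "t = (i', j', v')"
    by (metis prod_cases3)
  have "v l = v' l" for l using eq[of "Suc (Suc l)"] by (simp add: s t)
  then show "s = t" using eq[of 0] eq[of "Suc 0"] by (auto simp: s t)
qed

text \<open>The following two permutations are the shape of the images of \<open>a\<close> and \<open>b\<close>. The shift
  \<open>j - i\<close> is forced: \<open>b\<^sub>i\<^sub>+\<^sub>1 c\<^sub>i = b\<^sub>i\<close>, where each \<open>c\<^sub>i\<close> adds \<open>1\<close> to the second coordinate.\<close>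

lemma triangular_translation:
  "(\<lambda>(i, j, v). (i + 1, j, v)) \<in> triangular state_coord (m + 2)"
proof (rule triangularI)
  show "bij (\<lambda>(i :: int, j :: int, v :: nat \<Rightarrow> int). (i + 1, j, v))"
    by (rule o_bij[of "\<lambda>(i, j, v). (i - 1, j, v)"]) auto
next
  fix k and s :: state assume "m + 2 \<le> k"
  then have "k = Suc (Suc (k - 2))" by arith
  then obtain l where "k = Suc (Suc l)" ..
  then show "state_coord k ((\<lambda>(i, j, v). (i + 1, j, v)) s) = state_coord k s"
    by (cases s) (simp only: prod.case state_coord_simps)
next
  fix k and s t :: state
  show "state_coord k ((\<lambda>(i, j, v). (i + 1, j, v)) s) - state_coord k s =
      state_coord k ((\<lambda>(i, j, v). (i + 1, j, v)) t) - state_coord k t"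
    by (simp add: state_coord_def split: nat.split prod.split)
qed

lemma triangular_skew_product:
  assumes U: "\<And>i j. U i j \<in> triangular (\<lambda>k v. v k) m"
  shows "(\<lambda>(i, j, v). (i, j - i, U i j v)) \<in> triangular state_coord (m + 2)" (is "?b \<in> _")
proof (rule triangularI)
  have bij: "bij (U i j)" for i j by (rule triangular_bij[OF U])
  show "bij ?b"
  proof (rule bijI)
    show "inj ?b" by (rule injI) (auto simp: inj_eq[OF bij_is_inj[OF bij]])
    show "surj ?b"
    proof (rule surjI)
      fix s :: state
      show "?b ((\<lambda>(i, j, v). (i, j + i, inv_into UNIV (U i (j + i)) v)) s) = s"
        by (cases s) (simp add: surj_f_inv_f[OF bij_is_surj[OF bij]])
    qed
  qed
next
  fix k and s :: state assume "m + 2 \<le> k"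
  then have "k = Suc (Suc (k - 2))" "m \<le> k - 2" by arith+
  then obtain l where "k = Suc (Suc l)" "m \<le> l" by blast
  then show "state_coord k (?b s) = state_coord k s"
    using triangular_fixes[OF U] by (cases s) simp
next
  fix k and s t :: state
  assume agree: "\<And>j. j < k \<Longrightarrow> state_coord j s = state_coord j t"
  obtain i j v i' j' v' where s: "s = (i, j, v)" and t: "t = (i', j', v')"
    by (metis prod_cases3)
  consider "k = 0" | "k = Suc 0" | l where "k = Suc (Suc l)"
    by (metis not0_implies_Suc)
  then show "state_coord k (?b s) - state_coord k s = state_coord k (?b t) - state_coord k t"
  proof cases
    case 2
    then show ?thesis using agree[of 0] by (simp add: s t)
  next
    case 3
    have "i = i'" "j = j'" using agree[of 0] agree[of "Suc 0"] 3 by (simp_all add: s t)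
    moreover have "v x = v' x" if "x < l" for x
      using agree[of "Suc (Suc x)"] that 3 by (simp add: s t)
    then have "U i j v l - v l = U i j v' l - v' l"
      by (rule triangular_displacement[OF U])
    ultimately show ?thesis using 3 by (simp add: s t)
  qed (simp add: s t)
qed

text \<open>Here \<open>Y j\<close> and \<open>P i j\<close> are the permutations wanted for \<open>c ^ -j b c ^ j\<close> and \<open>c ^ -j c\<^sub>i ^ j\<close>. The
  images of \<open>a\<close> and \<open>b\<close> are \<open>(i, j, v) \<mapsto> (i + 1, j, v)\<close> and \<open>(i, j, v) \<mapsto> (i, j - i, U i j v)\<close>. The
  commutator should move along level \<open>i\<close> by \<open>(i, j, P i j v) \<mapsto> (i, j + 1, P i (j + 1) v)\<close>; in view of
  \<open>b\<^sub>i\<^sub>+\<^sub>1 c\<^sub>i = b\<^sub>i\<close> this means \<open>U (i + 1) (j + 1) \<circ> P i (j + 1) = U i j \<circ> P i j\<close>, a recursion along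
  each diagonal \<open>j - i = q\<close> that starts with \<open>Y q\<close> at \<open>i = 0\<close>. Since \<open>P i\<close> has period \<open>n\<close>, the \<open>n\<close>-th
  power of the commutator only adds \<open>n\<close> to \<open>j\<close>, on every level alike; so it commutes with \<open>a\<close>.\<close>

lemma action_on_states:
  fixes P :: "int \<Rightarrow> int \<Rightarrow> (nat \<Rightarrow> int) \<Rightarrow> nat \<Rightarrow> int"
  assumes Y: "\<And>j. Y j \<in> triangular (\<lambda>k v. v k) m"
    and P: "\<And>i j. P i j \<in> triangular (\<lambda>k v. v k) m"
    and periodic: "\<And>i j. P i (j + int n) = P i j"
  obtains \<alpha> \<beta> where "\<alpha> \<in> triangular state_coord (m + 2)" "\<beta> \<in> triangular state_coord (m + 2)"
    "\<And>i j v. \<alpha> (i, j, v) = (i + 1, j, v)"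
    "\<And>j v. \<beta> (0, j, v) = (0, j, Y j v)"
    "\<And>i j v. commutator (triangular_group state_coord (m + 2)) \<alpha> \<beta> (i, j, P i j v)
      = (i, j + 1, P i (j + 1) v)"
    "\<alpha> \<circ> commutator (triangular_group state_coord (m + 2)) \<alpha> \<beta> [^]\<^bsub>triangular_group state_coord (m + 2)\<^esub> n
      = commutator (triangular_group state_coord (m + 2)) \<alpha> \<beta> [^]\<^bsub>triangular_group state_coord (m + 2)\<^esub> n \<circ> \<alpha>"
proof -
  let ?S = "triangular_group (\<lambda>k (v :: nat \<Rightarrow> int). v k) m"
  let ?T = "triangular_group state_coord (m + 2)"
  interpret S: group ?S by (rule group_triangular_group)
  interpret T: group ?T by (rule group_triangular_group)
  \<comment> \<open>On the diagonal \<open>q = j - i\<close> the recursion reads \<open>u q (i + 1) = u q i \<circ> d q i\<close>.\<close>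
  define d where "d q i = P i (q + i) \<circ> inv_into UNIV (P i (q + i + 1))" for q i
  have "\<exists>u. (\<forall>i. u i \<in> triangular (\<lambda>k v. v k) m) \<and> u 0 = Y q \<and> (\<forall>i. u (i + 1) = u i \<circ> d q i)" for q
  proof -
    have "d q i \<in> carrier ?S" for i
      by (simp add: d_def triangular_comp triangular_inv P)
    then obtain u where "\<And>i. u i \<in> carrier ?S" "u 0 = Y q" "\<And>i. u (i + 1) = u i \<otimes>\<^bsub>?S\<^esub> d q i"
      using S.int_recursion[of "d q" "Y q"] Y by auto
    then show ?thesis by (intro exI[of _ u]) simp
  qed
  then obtain u where u: "\<And>q i. u q i \<in> triangular (\<lambda>k v. v k) m" and u0: "\<And>q. u q 0 = Y q"
    and u_step: "\<And>q i. u q (i + 1) = u q i \<circ> d q i"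
    by metis
  define U where "U i j = u (j - i) i" for i j
  have U: "U i j \<in> triangular (\<lambda>k v. v k) m" for i j by (simp add: U_def u)
  have U_step: "U (i + 1) (j + 1) (P i (j + 1) v) = U i j (P i j v)" for i j v
    using inv_f_f[OF bij_is_inj[OF triangular_bij[OF P]]] u_step[of "j - i" i]
    by (simp add: U_def d_def)
  define \<alpha> :: "state \<Rightarrow> state" where "\<alpha> = (\<lambda>(i, j, v). (i + 1, j, v))"
  define \<beta> :: "state \<Rightarrow> state" where "\<beta> = (\<lambda>(i, j, v). (i, j - i, U i j v))"
  have \<alpha>: "\<alpha> \<in> triangular state_coord (m + 2)"
    unfolding \<alpha>_def by (rule triangular_translation)
  have \<beta>: "\<beta> \<in> triangular state_coord (m + 2)"
    unfolding \<beta>_def by (rule triangular_skew_product) (rule U)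
  have \<alpha>_apply: "\<alpha> (i, j, v) = (i + 1, j, v)" for i j v by (simp add: \<alpha>_def)
  let ?c = "commutator ?T \<alpha> \<beta>"
  have c: "?c \<in> triangular state_coord (m + 2)"
    using T.commutator_closed[of \<alpha> \<beta>] \<alpha> \<beta> by simp
  have c_apply: "?c (i, j, P i j v) = (i, j + 1, P i (j + 1) v)" for i j v
  proof -
    \<comment> \<open>The equation \<open>\<alpha> \<beta> = \<beta> \<alpha> [\<alpha>, \<beta>]\<close> avoids inverses.\<close>
    have "\<alpha> (\<beta> (i, j, P i j v)) = \<beta> (\<alpha> (i, j + 1, P i (j + 1) v))"
      by (simp add: \<alpha>_def \<beta>_def U_step)
    then show ?thesis
      using inv_f_f[OF bij_is_inj[OF triangular_bij[OF \<alpha>]]]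
        inv_f_f[OF bij_is_inj[OF triangular_bij[OF \<beta>]]]
      by (simp add: commutator_def inv_triangular_group[OF \<alpha>] inv_triangular_group[OF \<beta>] del: add_2_eq_Suc')
  qed
  have c_pow: "(?c [^]\<^bsub>?T\<^esub> n) (i, j, v) = (i, j + int n, v)" for i j v
  proof -
    obtain v' where v: "v = P i j v'"
      by (rule surjE[OF bij_is_surj[OF triangular_bij[OF P]]])
    have "(?c [^]\<^bsub>?T\<^esub> int n) (i, j, P i j v') = (i, j + int n, P i (j + int n) v')"
      by (rule triangular_pow_orbit[OF c, of "\<lambda>j. (i, j, P i j v')"]) (rule c_apply)
    then show ?thesis by (simp add: v periodic int_pow_int)
  qed
  have "\<alpha> \<circ> ?c [^]\<^bsub>?T\<^esub> n = ?c [^]\<^bsub>?T\<^esub> n \<circ> \<alpha>"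
    by (auto simp: fun_eq_iff \<alpha>_apply c_pow simp del: add_2_eq_Suc')
  moreover have "\<beta> (0, j, v) = (0, j, Y j v)" for j v
    by (simp add: \<beta>_def U_def u0)
  ultimately show thesis
    using that[of \<alpha> \<beta>] \<alpha> \<beta> \<alpha>_apply c_apply by blast
qed

section \<open>Detecting reduced words by transvections\<close>

text \<open>The unitriangular matrix \<open>1 + e N\<close>, where \<open>N\<close> adds entry \<open>k\<close> to entry \<open>k + 1\<close> for every
  position \<open>k\<close> that carries the letter \<open>x\<close>.\<close>

definition transvection :: "(nat \<Rightarrow> 'x option) \<Rightarrow> 'x \<Rightarrow> int \<Rightarrow> (nat \<Rightarrow> int) \<Rightarrow> nat \<Rightarrow> int"
  where "transvection l x e v k =
    (case k of 0 \<Rightarrow> v 0 | Suc k' \<Rightarrow> v (Suc k') + (if l k' = Some x then e * v k' else 0))"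

lemma transvection_simps [simp]:
  "transvection l x e v 0 = v 0"
  "transvection l x e v (Suc k) = v (Suc k) + (if l k = Some x then e * v k else 0)"
  by (simp_all add: transvection_def)

lemma transvection_zero [simp]: "transvection l x 0 v = v"
proof
  show "transvection l x 0 v k = v k" for k by (cases k) simp_all
qed

text \<open>Equal letters never stand in adjacent positions, so the matrix \<open>N\<close> has square zero and
  \<open>1 + e N\<close> is the \<open>e\<close>-th power of \<open>1 + N\<close>.\<close>

lemma transvection_add:
  assumes "\<And>k. l k = Some x \<Longrightarrow> l (Suc k) \<noteq> Some x"
  shows "transvection l x e (transvection l x f v) = transvection l x (e + f) v"
proof
  fix k
  show "transvection l x e (transvection l x f v) k = transvection l x (e + f) v k"
  proof (cases k)
    case (Suc k')
    show ?thesis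
    proof (cases "l k' = Some x")
      case True
      have "transvection l x f v k' = v k'"
        using assms True by (cases k') auto
      then show ?thesis using True by (simp add: Suc algebra_simps)
    qed (simp add: Suc)
  qed simp
qed

lemma transvection_triangular:
  assumes adj: "\<And>k. l k = Some x \<Longrightarrow> l (Suc k) \<noteq> Some x"
    and bound: "\<And>k. m \<le> k \<Longrightarrow> l k = None"
  shows "transvection l x e \<in> triangular (\<lambda>k v. v k) (Suc m)"
proof (rule triangularI)
  have add: "transvection l x e (transvection l x f v) = transvection l x (e + f) v" for e f v
    using adj by (rule transvection_add)
  show "bij (transvection l x e)"
    by (rule o_bij[of "transvection l x (- e)"]) (simp_all add: fun_eq_iff add)
next
  fix k and s t :: "nat \<Rightarrow> int" assume "\<And>j. j < k \<Longrightarrow> s j = t j"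
  then show "transvection l x e s k - s k = transvection l x e t k - t k"
    by (cases k) auto
next
  fix k and s :: "nat \<Rightarrow> int" assume "Suc m \<le> k"
  then show "transvection l x e s k = s k"
    using bound by (cases k) auto
qed

text \<open>A word is a list of syllables: a letter with its exponent.\<close>

primrec syllable_eval :: "('g, 'm) monoid_scheme \<Rightarrow> ('x \<Rightarrow> 'g) \<Rightarrow> ('x \<times> int) list \<Rightarrow> 'g" where
  "syllable_eval H g [] = \<one>\<^bsub>H\<^esub>"
| "syllable_eval H g (s # w) = g (fst s) [^]\<^bsub>H\<^esub> snd s \<otimes>\<^bsub>H\<^esub> syllable_eval H g w"

definition reduced :: "('x \<times> int) list \<Rightarrow> bool"
  where "reduced w \<longleftrightarrow> (\<forall>s\<in>set w. snd s \<noteq> 0) \<and> distinct_adj (map fst w)"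

lemma reduced_Cons:
  "reduced ((x, e) # w) \<longleftrightarrow> e \<noteq> 0 \<and> reduced w \<and> (w \<noteq> [] \<longrightarrow> x \<noteq> fst (hd w))"
  by (cases w) (auto simp: reduced_def)

context group
begin

lemma syllable_eval_closed [simp]:
  "fst ` set w \<subseteq> X \<Longrightarrow> g ` X \<subseteq> carrier G \<Longrightarrow> syllable_eval G g w \<in> carrier G"
  by (induction w) (auto simp: image_subset_iff)

lemma syllable_eval_append:
  assumes "fst ` set w \<subseteq> X" "fst ` set w' \<subseteq> X" "g ` X \<subseteq> carrier G"
  shows "syllable_eval G g (w @ w') = syllable_eval G g w \<otimes> syllable_eval G g w'"
  using assms
proof (induction w)
  case Nil
  then show ?case using syllable_eval_closed[of w' X g] by simp
next
  case (Cons s w)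
  have "g (fst s) \<in> carrier G" using Cons.prems by auto
  moreover have "syllable_eval G g w \<in> carrier G" "syllable_eval G g w' \<in> carrier G"
    using Cons.prems by (auto intro: syllable_eval_closed)
  ultimately show ?case using Cons by (simp add: m_assoc)
qed

text \<open>Inverses of generators are syllables with exponent \<open>-1\<close>, and products are concatenations.\<close>

lemma generate_eq_syllable_eval:
  assumes g: "g ` X \<subseteq> carrier G" and h: "h \<in> generate G (g ` X)"
  shows "\<exists>w. fst ` set w \<subseteq> X \<and> h = syllable_eval G g w"
  using h
proof induction
  case one
  then show ?case by (intro exI[of _ "[]"]) simp
next
  case (incl h)
  then obtain x where "x \<in> X" "h = g x" by blast
  then show ?case using g by (intro exI[of _ "[(x, 1)]"]) auto
next
  case (inv h)
  then obtain x where "x \<in> X" "h = g x" by blast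
  then show ?case using g by (intro exI[of _ "[(x, - 1)]"]) (auto simp: int_pow_neg)
next
  case (eng h h')
  then obtain w w' where "fst ` set w \<subseteq> X" "h = syllable_eval G g w"
    "fst ` set w' \<subseteq> X" "h' = syllable_eval G g w'" by blast
  then show ?case
    using g by (intro exI[of _ "w @ w'"]) (auto simp: syllable_eval_append)
qed

text \<open>A syllable put in front of a reduced word is merged with the first syllable if their letters
  agree, and disappears if its exponent is or becomes zero.\<close>

lemma reduce_syllables:
  assumes g: "g ` X \<subseteq> carrier G" and w: "fst ` set w \<subseteq> X"
  shows "\<exists>w'. fst ` set w' \<subseteq> X \<and> reduced w' \<and> syllable_eval G g w' = syllable_eval G g w"
  using w
proof (induction w)
  case Nil
  then show ?case by (intro exI[of _ "[]"]) (simp add: reduced_def)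
next
  case (Cons s w)
  obtain x e where s: "s = (x, e)" by fastforce
  have x: "x \<in> X" "g x \<in> carrier G" using Cons.prems g by (auto simp: s)
  obtain w' where w': "fst ` set w' \<subseteq> X" "reduced w'" "syllable_eval G g w' = syllable_eval G g w"
    using Cons.IH Cons.prems by (meson image_mono order_trans set_subset_Cons)
  have closed: "syllable_eval G g w' \<in> carrier G" using w'(1) g by (rule syllable_eval_closed)
  consider "e = 0" | "e \<noteq> 0" "w' \<noteq> [] \<longrightarrow> x \<noteq> fst (hd w')" | f u where "w' = (x, f) # u"
  proof (cases "w' = [] \<or> x \<noteq> fst (hd w')")
    case False
    then have "w' = (x, snd (hd w')) # tl w'" by (cases w') auto
    then show thesis by (rule that(3))
  qed (use that(1,2) in blast)
  then show ?case
  proof cases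
    case 1
    then show ?thesis using w' closed by (intro exI[of _ w']) (simp add: s)
  next
    case 2
    then show ?thesis using w' x by (intro exI[of _ "(x, e) # w'"]) (simp add: s reduced_Cons)
  next
    case 3
    have u: "syllable_eval G g u \<in> carrier G"
      using w'(1) g 3 by (intro syllable_eval_closed[of u X]) auto
    have eq: "g x [^] (e + f) \<otimes> syllable_eval G g u = syllable_eval G g (s # w)"
      using w'(3)[symmetric] x u by (simp add: s 3 int_pow_mult m_assoc)
    show ?thesis
    proof (cases "e + f = 0")
      case True
      then show ?thesis using w' u eq 3 by (intro exI[of _ u]) (simp add: reduced_Cons)
    next
      case False
      then show ?thesis
        using w' u eq 3 by (intro exI[of _ "(x, e + f) # u"]) (simp add: reduced_Cons)
    qed
  qed
qed

end

lemma (in group_hom) hom_syllable_eval: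
  assumes "fst ` set w \<subseteq> X" "g ` X \<subseteq> carrier G"
  shows "h (syllable_eval G g w) = syllable_eval H (h \<circ> g) w"
  using assms
proof (induction w)
  case (Cons s w)
  then have "g (fst s) \<in> carrier G" "syllable_eval G g w \<in> carrier G"
    by (auto intro: G.syllable_eval_closed)
  then show ?case using Cons by (simp add: hom_int_pow)
qed simp

text \<open>Positions are counted from the right end because the last syllable of a word acts first.\<close>

definition letter_at :: "('x \<times> int) list \<Rightarrow> nat \<Rightarrow> 'x option"
  where "letter_at w k = (if k < length w then Some (fst (rev w ! k)) else None)"

lemma letter_at_adjacent:
  assumes "reduced w" "letter_at w k = Some x"
  shows "letter_at w (Suc k) \<noteq> Some x"
proof
  assume eq: "letter_at w (Suc k) = Some x"
  then have k: "Suc k < length w" by (simp add: letter_at_def split: if_splits)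
  let ?i = "length w - Suc (Suc k)"
  have "Suc ?i = length w - Suc k" using k by simp
  moreover have "map fst w ! ?i \<noteq> map fst w ! Suc ?i"
    using assms(1) k by (simp add: reduced_def distinct_adj_conv_nth)
  ultimately show False
    using assms(2) eq k by (auto simp: letter_at_def rev_nth split: if_splits)
qed

text \<open>The vector starts with only entry \<open>0\<close> nonzero. A syllable \<open>(x, e)\<close> acting after \<open>k\<close> others finds
  its letter at position \<open>k\<close> and the entries above \<open>k\<close> still zero, so it puts \<open>e\<close> times entry \<open>k\<close> into
  entry \<open>k + 1\<close>. Hence each syllable advances the last nonzero entry by exactly one.\<close>

lemma transvections_detect:
  assumes "\<And>k. k < length w \<Longrightarrow> l k = Some (fst (rev w ! k))" and "\<forall>s\<in>set w. snd s \<noteq> 0"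
    and "v 0 \<noteq> 0" "\<And>k. 0 < k \<Longrightarrow> v k = 0"
  shows "foldr (\<lambda>s. transvection l (fst s) (snd s)) w v (length w) \<noteq> 0 \<and>
    (\<forall>k>length w. foldr (\<lambda>s. transvection l (fst s) (snd s)) w v k = 0)"
  using assms(1,2)
proof (induction w)
  case Nil
  then show ?case using assms by simp
next
  case (Cons s w)
  let ?v = "foldr (\<lambda>s. transvection l (fst s) (snd s)) w v"
  have "l k = Some (fst (rev w ! k))" if "k < length w" for k
    using Cons.prems(1)[of k] that by (simp add: nth_append)
  then have IH: "?v (length w) \<noteq> 0" "\<And>k. length w < k \<Longrightarrow> ?v k = 0"
    using Cons by auto
  have "l (length w) = Some (fst s)"
    using Cons.prems(1)[of "length w"] by (simp add: nth_append)
  then have "transvection l (fst s) (snd s) ?v (length (s # w)) \<noteq> 0"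
    using IH Cons.prems(2) by simp
  moreover have "transvection l (fst s) (snd s) ?v k = 0" if "length (s # w) < k" for k
    using that IH(2) by (cases k) auto
  ultimately show ?case by simp
qed

section \<open>Normal forms\<close>

text \<open>Names for the basis of the free kernel: \<open>Conj_b j\<close> stands for \<open>c ^ -j b c ^ j\<close>, and
  \<open>Power_quot i j\<close> for \<open>c ^ -j c\<^sub>i ^ j\<close>.\<close>

datatype basis = Conj_b int | Power_quot int int

context group
begin

text \<open>With associativity this rule brings products of powers into a canonical form.\<close>

lemma int_pow_cancel:
  assumes "x \<in> carrier G" "y \<in> carrier G"
  shows "x [^] (i :: int) \<otimes> (x [^] (j :: int) \<otimes> y) = x [^] (i + j) \<otimes> y"
  using assms by (simp add: int_pow_mult m_assoc)

lemma conjugate_int_pow: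
  assumes x: "x \<in> carrier G" and y: "y \<in> carrier G"
  shows "(x [^] (- i) \<otimes> (y \<otimes> x [^] i)) [^] (e :: int) = x [^] (- i :: int) \<otimes> (y [^] e \<otimes> x [^] i)"
proof -
  let ?h = "\<lambda>y. x [^] (- i) \<otimes> (y \<otimes> x [^] i)"
  have "?h \<in> hom G G"
    by (rule homI) (simp_all add: x m_assoc int_pow_cancel)
  then interpret group_hom G G ?h
    by (simp add: group_hom_def group_hom_axioms_def)
  show ?thesis using hom_int_pow[OF y] by simp
qed

lemma int_pow_commute:
  assumes x: "x \<in> carrier G" and y: "y \<in> carrier G" and comm: "x \<otimes> y = y \<otimes> x"
  shows "x [^] (i :: int) \<otimes> y [^] (j :: int) = y [^] j \<otimes> x [^] i"
proof -
  have *: "u [^] (i :: int) \<otimes> v = v \<otimes> u [^] i"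
    if u: "u \<in> carrier G" and v: "v \<in> carrier G" and comm: "u \<otimes> v = v \<otimes> u" for u v i
  proof -
    have "v [^] (- 1 :: int) \<otimes> (u \<otimes> v [^] (1 :: int)) = u"
      using u v comm by (simp add: int_pow_neg inv_solve_left')
    then have "u [^] i = v [^] (- 1 :: int) \<otimes> (u [^] i \<otimes> v [^] (1 :: int))"
      using conjugate_int_pow[OF v u, of 1 i] by simp
    then have "v \<otimes> u [^] i = v [^] (1 :: int) \<otimes> (v [^] (- 1 :: int) \<otimes> (u [^] i \<otimes> v [^] (1 :: int)))"
      using v by simp
    also have "\<dots> = u [^] i \<otimes> v"
      using u v by (simp only: int_pow_cancel int_pow_closed m_closed) simp
    finally show ?thesis by simp
  qed
  have "y [^] j \<otimes> x = x \<otimes> y [^] j" using *[OF y x] comm by simp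
  then show ?thesis using *[OF x, of "y [^] j" i] y by simp
qed

end

locale commuting_commutator_power = group G for G (structure) +
  fixes a b and n :: nat
  assumes a [simp]: "a \<in> carrier G" and b [simp]: "b \<in> carrier G"
    and commutes: "a \<otimes> commutator G a b [^] n = commutator G a b [^] n \<otimes> a"
begin

abbreviation c where "c \<equiv> commutator G a b"

text \<open>These are the conjugates \<open>c\<^sub>i\<close> and \<open>b\<^sub>i\<close>.\<close>

definition comm_shift :: "int \<Rightarrow> 'a"
  where "comm_shift i = a [^] (- i) \<otimes> (c \<otimes> a [^] i)"

definition b_shift :: "int \<Rightarrow> 'a"
  where "b_shift i = a [^] (- i) \<otimes> (b \<otimes> a [^] i)"

primrec basis_elem :: "basis \<Rightarrow> 'a" where
  "basis_elem (Conj_b j) = c [^] (- j) \<otimes> (b \<otimes> c [^] j)"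
| "basis_elem (Power_quot i j) = c [^] (- j) \<otimes> comm_shift i [^] j"

text \<open>The condition \<open>j mod n = j\<close> picks one index of each residue class; index \<open>0\<close> and level \<open>0\<close> are left
  out because \<open>c ^ -j c\<^sub>i ^ j\<close> is trivial there.\<close>

definition basis_letters :: "basis set"
  where "basis_letters = range Conj_b \<union> {Power_quot i j |i j. i \<noteq> 0 \<and> j \<noteq> 0 \<and> j mod int n = j}"

abbreviation basis_span where "basis_span \<equiv> generate G (basis_elem ` basis_letters)"

text \<open>This product set is the normal closure of \<open>b\<close> in the group generated by \<open>a\<close> and \<open>b\<close>.\<close>

definition shift_span :: "'a set"
  where "shift_span = {c [^] (q :: int) \<otimes> l |q l. l \<in> basis_span}"

lemma comm_shift_closed [simp]: "comm_shift i \<in> carrier G"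
  and b_shift_closed [simp]: "b_shift i \<in> carrier G"
  by (simp_all add: comm_shift_def b_shift_def)

lemma basis_elem_closed [simp]: "basis_elem x \<in> carrier G"
  by (cases x) simp_all

lemma basis_elem_image_carrier: "basis_elem ` X \<subseteq> carrier G"
  by auto

lemma basis_span_carrier: "l \<in> basis_span \<Longrightarrow> l \<in> carrier G"
  by (rule generate_in_carrier[OF basis_elem_image_carrier])

lemma basis_span_inv: "l \<in> basis_span \<Longrightarrow> inv l \<in> basis_span"
  by (rule generate_m_inv_closed[OF basis_elem_image_carrier])

lemma comm_shift_pow: "comm_shift i [^] (e :: int) = a [^] (- i) \<otimes> (c [^] e \<otimes> a [^] i)"
  unfolding comm_shift_def by (rule conjugate_int_pow) simp_all

lemma comm_shift_0: "comm_shift 0 = c"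
  by (simp add: comm_shift_def)

text \<open>The only use of the defining relation: \<open>a ^ i\<close> commutes with the powers of \<open>c ^ n\<close>.\<close>

lemma comm_shift_pow_multiple: "comm_shift i [^] (int n * k) = c [^] (int n * k)"
proof -
  have "a [^] i \<otimes> (c [^] n) [^] k = (c [^] n) [^] k \<otimes> a [^] i"
    by (rule int_pow_commute[OF _ _ commutes]) simp_all
  moreover have "(c [^] n) [^] k = c [^] (int n * k)"
    by (simp add: int_pow_pow flip: int_pow_int)
  ultimately have "c [^] (int n * k) \<otimes> a [^] i = a [^] i \<otimes> c [^] (int n * k)" by simp
  then show ?thesis by (simp add: comm_shift_pow int_pow_cancel)
qed

lemma basis_elem_Power_quot_periodic:
  "basis_elem (Power_quot i (j + int n * k)) = basis_elem (Power_quot i j)"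
proof -
  have "basis_elem (Power_quot i (j + int n * k)) =
      c [^] (- j - int n * k) \<otimes> comm_shift i [^] (int n * k + j)"
    by (simp add: add.commute)
  also have "\<dots> = c [^] (- j - int n * k) \<otimes> (c [^] (int n * k) \<otimes> comm_shift i [^] j)"
    by (simp only: int_pow_mult[OF comm_shift_closed] comm_shift_pow_multiple)
  also have "\<dots> = basis_elem (Power_quot i j)" by (simp add: int_pow_cancel)
  finally show ?thesis .
qed

lemma basis_elem_Power_quot_in_span: "basis_elem (Power_quot i j) \<in> basis_span"
proof -
  let ?k = "j mod int n"
  have eq: "basis_elem (Power_quot i j) = basis_elem (Power_quot i ?k)"
    using basis_elem_Power_quot_periodic[of i ?k "j div int n"] by simp
  show ?thesis
  proof (cases "i = 0 \<or> ?k = 0")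
    case True
    then have "basis_elem (Power_quot i ?k) = \<one>"
      by (auto simp: comm_shift_0 int_pow_mult[symmetric])
    then show ?thesis by (simp only: eq generate.one)
  next
    case False
    then have "Power_quot i ?k \<in> basis_letters" by (simp add: basis_letters_def)
    then show ?thesis unfolding eq by (intro generate.incl imageI)
  qed
qed

lemma basis_elem_Conj_b_in_span: "basis_elem (Conj_b j) \<in> basis_span"
  by (intro generate.incl imageI) (simp add: basis_letters_def)

text \<open>Conjugation by \<open>c ^ k\<close> maps \<open>c ^ -j b c ^ j\<close> to the element of the same kind with index \<open>j + k\<close>, and
  \<open>c ^ -j c\<^sub>i ^ j\<close> to \<open>c ^ -(j + k) c\<^sub>i ^ (j + k)\<close> times the inverse of \<open>c ^ -k c\<^sub>i ^ k\<close>.\<close>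

lemma basis_elem_conjugate: "c [^] (- k) \<otimes> (basis_elem x \<otimes> c [^] (k :: int)) \<in> basis_span"
proof (cases x)
  case (Conj_b j)
  have "c [^] (- k) \<otimes> (basis_elem (Conj_b j) \<otimes> c [^] k) = basis_elem (Conj_b (j + k))"
    by (simp add: m_assoc int_pow_cancel int_pow_mult[symmetric] minus_diff_commute)
  then show ?thesis by (simp only: Conj_b basis_elem_Conj_b_in_span)
next
  case (Power_quot i j)
  have "inv basis_elem (Power_quot i k) = comm_shift i [^] (- k) \<otimes> c [^] k"
    by (simp add: inv_mult_group int_pow_neg)
  then have "basis_elem (Power_quot i (j + k)) \<otimes> inv basis_elem (Power_quot i k) =
      c [^] (- k) \<otimes> (basis_elem (Power_quot i j) \<otimes> c [^] k)"
    by (simp add: m_assoc int_pow_cancel minus_diff_commute)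
  then show ?thesis
    by (metis Power_quot basis_elem_Power_quot_in_span basis_span_inv generate.eng)
qed

lemma basis_span_conjugate: "l \<in> basis_span \<Longrightarrow> c [^] (- k) \<otimes> (l \<otimes> c [^] (k :: int)) \<in> basis_span"
proof (induction rule: generate.induct)
  case one
  then show ?case by (simp add: int_pow_mult[symmetric] generate.one)
next
  case (incl h)
  then show ?case using basis_elem_conjugate by blast
next
  case (inv h)
  then obtain x where h: "h = basis_elem x" by blast
  have "c [^] (- k) \<otimes> (inv h \<otimes> c [^] k) = inv (c [^] (- k) \<otimes> (h \<otimes> c [^] k))"
    by (simp add: h inv_mult_group int_pow_neg m_assoc)
  then show ?case using basis_span_inv inv basis_elem_conjugate h by metis
next
  case (eng h h')
  then have "h \<in> carrier G" "h' \<in> carrier G" by (simp_all add: basis_span_carrier)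
  then have "c [^] (- k) \<otimes> (h \<otimes> h' \<otimes> c [^] k) =
      (c [^] (- k) \<otimes> (h \<otimes> c [^] k)) \<otimes> (c [^] (- k) \<otimes> (h' \<otimes> c [^] k))"
    by (simp add: m_assoc int_pow_cancel)
  then show ?case using generate.eng eng by metis
qed

lemma shift_span_carrier: "x \<in> shift_span \<Longrightarrow> x \<in> carrier G"
  by (auto simp: shift_span_def basis_span_carrier)

text \<open>The set \<open>shift_span\<close> is not yet known to be a subgroup. Its left multipliers are visibly closed
  under products, so it is enough to find the generators \<open>c\<close>, \<open>c\<^sub>i\<close> and \<open>b\<close> among them.\<close>

definition left_multipliers :: "'a set"
  where "left_multipliers = {x \<in> carrier G. \<forall>y\<in>shift_span. x \<otimes> y \<in> shift_span}"

lemma left_multipliers_mult: "x \<in> left_multipliers \<Longrightarrow> y \<in> left_multipliers \<Longrightarrow> x \<otimes> y \<in> left_multipliers"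
  by (auto simp: left_multipliers_def m_assoc shift_span_carrier)

lemma c_pow_left_multipliers: "c [^] (k :: int) \<in> left_multipliers"
proof -
  have "c [^] k \<otimes> (c [^] q \<otimes> l) \<in> shift_span" if "l \<in> basis_span" for q :: int and l
    using that by (auto simp: shift_span_def int_pow_cancel basis_span_carrier)
  then show ?thesis by (auto simp: left_multipliers_def shift_span_def)
qed

lemma basis_span_left_multipliers:
  assumes x: "x \<in> basis_span"
  shows "x \<in> left_multipliers"
proof -
  have "x \<otimes> (c [^] q \<otimes> l) \<in> shift_span" if l: "l \<in> basis_span" for q :: int and l
  proof -
    have "x \<otimes> (c [^] q \<otimes> l) = c [^] q \<otimes> ((c [^] (- q) \<otimes> (x \<otimes> c [^] q)) \<otimes> l)"
      using basis_span_carrier[OF x] basis_span_carrier[OF l] by (simp add: m_assoc int_pow_cancel)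
    moreover have "(c [^] (- q) \<otimes> (x \<otimes> c [^] q)) \<otimes> l \<in> basis_span"
      by (intro generate.eng basis_span_conjugate x l)
    ultimately show ?thesis unfolding shift_span_def by blast
  qed
  then show ?thesis using basis_span_carrier[OF x] by (auto simp: left_multipliers_def shift_span_def)
qed

lemma comm_shift_pow_left_multipliers: "comm_shift i [^] (j :: int) \<in> left_multipliers"
proof -
  have "comm_shift i [^] j = c [^] j \<otimes> basis_elem (Power_quot i j)" by (simp add: int_pow_cancel)
  then show ?thesis
    using left_multipliers_mult c_pow_left_multipliers basis_span_left_multipliers basis_elem_Power_quot_in_span by metis
qed

lemma b_shift_step: "b_shift (i + 1) \<otimes> comm_shift i = b_shift i"
proof -
  have pow: "a [^] (i + 1) = a \<otimes> a [^] i" "a [^] (- (i + 1)) = a [^] (- i) \<otimes> inv a" for i :: int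
    using int_pow_mult[OF a, of 1 i] int_pow_mult[OF a, of "- i" "- 1"]
    by (simp_all add: add.commute int_pow_neg)
  have [simp]: "inv a \<otimes> (a \<otimes> y) = y" "a \<otimes> (inv a \<otimes> y) = y"
    "inv b \<otimes> (b \<otimes> y) = y" "b \<otimes> (inv b \<otimes> y) = y" if "y \<in> carrier G" for y
    using that by (simp_all flip: m_assoc)
  show ?thesis
    by (simp add: b_shift_def comm_shift_def pow commutator_def m_assoc int_pow_cancel del: minus_add_distrib)
qed

text \<open>Induction in both directions from \<open>b\<^sub>0 = b\<close> by the recurrence \<open>b\<^sub>i\<^sub>+\<^sub>1 c\<^sub>i = b\<^sub>i\<close>. Inverses are carried
  along because left multipliers are not obviously closed under them.\<close>

lemma b_shift_left_multipliers: "b_shift i \<in> left_multipliers \<and> inv b_shift i \<in> left_multipliers"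
proof (induction i rule: int_induct[of _ 0])
  case base
  have "b_shift 0 = basis_elem (Conj_b 0)" by (simp add: b_shift_def)
  then show ?case using basis_span_left_multipliers basis_span_inv basis_elem_Conj_b_in_span by metis
next
  case (step1 i)
  have "b_shift (i + 1) = b_shift i \<otimes> comm_shift i [^] (- 1 :: int)"
    using b_shift_step[of i] by (simp add: int_pow_neg inv_solve_right)
  moreover from this have "inv b_shift (i + 1) = comm_shift i [^] (1 :: int) \<otimes> inv b_shift i"
    by (simp add: inv_mult_group int_pow_neg)
  ultimately show ?case using step1 comm_shift_pow_left_multipliers left_multipliers_mult by metis
next
  case (step2 i)
  have "b_shift (i - 1) = b_shift i \<otimes> comm_shift (i - 1) [^] (1 :: int)"
    using b_shift_step[of "i - 1"] by simp
  moreover from this have "inv b_shift (i - 1) = comm_shift (i - 1) [^] (- 1 :: int) \<otimes> inv b_shift i"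
    by (simp add: inv_mult_group int_pow_neg)
  ultimately show ?case using step2 comm_shift_pow_left_multipliers left_multipliers_mult by metis
qed

definition normal_forms :: "'a set"
  where "normal_forms = {a [^] (p :: int) \<otimes> (c [^] (q :: int) \<otimes> l) |p q l. l \<in> basis_span}"

lemma normal_forms_alt: "normal_forms = {a [^] (p :: int) \<otimes> y |p y. y \<in> shift_span}"
  by (auto simp: normal_forms_def shift_span_def)

lemma one_normal_forms: "\<one> \<in> normal_forms"
  unfolding normal_forms_def
  by (rule CollectI, intro exI[of _ 0] exI[of _ \<one>]) (simp add: generate.one)

text \<open>Moving \<open>b\<close> past \<open>a ^ p\<close> turns it into \<open>b\<^sub>p\<close>, which is a left multiplier of \<open>shift_span\<close>.\<close>

lemma normal_forms_mult_left:
  assumes x: "x \<in> normal_forms"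
  shows "a \<otimes> x \<in> normal_forms" "inv a \<otimes> x \<in> normal_forms"
    "b \<otimes> x \<in> normal_forms" "inv b \<otimes> x \<in> normal_forms"
proof -
  obtain p :: int and y where xy: "x = a [^] p \<otimes> y" and y: "y \<in> shift_span"
    using x by (auto simp: normal_forms_alt)
  have yc: "y \<in> carrier G" using y by (rule shift_span_carrier)
  have a_pow: "a [^] k \<otimes> x \<in> normal_forms" for k :: int
    using y yc unfolding normal_forms_alt xy by (auto simp: int_pow_cancel)
  show "a \<otimes> x \<in> normal_forms" "inv a \<otimes> x \<in> normal_forms"
    using a_pow[of 1] a_pow[of "- 1"] by (simp_all add: int_pow_neg)
  have "inv b_shift p = a [^] (- p) \<otimes> (inv b \<otimes> a [^] p)"
    by (simp add: b_shift_def m_assoc inv_mult_group int_pow_neg)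
  then have "b \<otimes> x = a [^] p \<otimes> (b_shift p \<otimes> y)" "inv b \<otimes> x = a [^] p \<otimes> (inv b_shift p \<otimes> y)"
    by (simp_all add: xy b_shift_def yc m_assoc int_pow_cancel)
  moreover have "b_shift p \<otimes> y \<in> shift_span" "inv b_shift p \<otimes> y \<in> shift_span"
    using b_shift_left_multipliers y by (auto simp: left_multipliers_def)
  ultimately show "b \<otimes> x \<in> normal_forms" "inv b \<otimes> x \<in> normal_forms"
    unfolding normal_forms_alt by blast+
qed

lemma normal_forms_cases:
  assumes "x \<in> normal_forms"
  obtains p q w where "fst ` set w \<subseteq> basis_letters" "reduced w"
    "x = a [^] (p :: int) \<otimes> (c [^] (q :: int) \<otimes> syllable_eval G basis_elem w)"
proof -
  obtain p q l where x: "x = a [^] (p :: int) \<otimes> (c [^] (q :: int) \<otimes> l)" and "l \<in> basis_span"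
    using assms by (auto simp: normal_forms_def)
  then obtain w where "fst ` set w \<subseteq> basis_letters" "l = syllable_eval G basis_elem w"
    using generate_eq_syllable_eval[OF basis_elem_image_carrier] by blast
  then show thesis using that reduce_syllables[OF basis_elem_image_carrier] x by metis
qed

end

section \<open>Residual solvability\<close>

lemma (in group_hom) hom_commutator:
  "x \<in> carrier G \<Longrightarrow> y \<in> carrier G \<Longrightarrow> h (commutator G x y) = commutator H (h x) (h y)"
  by (simp add: commutator_def)

text \<open>A basis element starts at \<open>(0, 0, v)\<close>, is carried by powers of \<open>c\<close> or \<open>c\<^sub>i\<close> along level \<open>0\<close> and
  is brought back to the origin, having changed \<open>v\<close> by its transvection. So the word acts on the
  sequence alone, and then \<open>c ^ q\<close> and \<open>a ^ p\<close> record their exponents in the two other coordinates.\<close>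

lemma (in commuting_commutator_power) hom_normal_form:
  fixes h :: "'a \<Rightarrow> state \<Rightarrow> state" and v :: "nat \<Rightarrow> int" and p q :: int
  assumes h: "h \<in> hom G (triangular_group state_coord m)"
    and ha: "\<And>i j v. h a (i, j, v) = (i + 1, j, v)"
    and hb: "\<And>j v. h b (0, j, v) = (0, j, transvection l (Conj_b j) 1 v)"
    and hc: "\<And>i j v. h c (i, j, P i j v) = (i, j + 1, P i (j + 1) v)"
    and P0: "\<And>j. P 0 j = id" "\<And>i. P i 0 = id"
    and P: "\<And>i j. Power_quot i j \<in> basis_letters \<Longrightarrow> P i j = transvection l (Power_quot i j) 1"
    and adj: "\<And>k x. l k = Some x \<Longrightarrow> l (Suc k) \<noteq> Some x"
    and w: "fst ` set w \<subseteq> basis_letters"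
  shows "h (a [^] p \<otimes> (c [^] q \<otimes> syllable_eval G basis_elem w)) (0, 0, v)
    = (p, q, foldr (\<lambda>s. transvection l (fst s) (snd s)) w v)"
proof -
  let ?T = "triangular_group state_coord m"
  interpret h: group_hom G ?T h
    using h group_triangular_group by (simp add: group_hom_def group_hom_axioms_def)
  have tri: "h x \<in> triangular state_coord m" if "x \<in> carrier G" for x
    using h.hom_closed[OF that] by simp
  have orbit: "h (x [^] e) (s i) = s (i + e)"
    if x: "x \<in> carrier G" and step: "\<And>i. h x (s i) = s (i + 1)" for x s and i e :: int
    unfolding h.hom_int_pow[OF x] by (rule triangular_pow_orbit[OF tri[OF x]]) (rule step)
  have mult: "h (x \<otimes> y) s = h x (h y s)" if "x \<in> carrier G" "y \<in> carrier G" for x y s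
    using that by simp
  have a_pow: "h (a [^] e) (i, j, v) = (i + e, j, v)" for i j v e
    using orbit[of a "\<lambda>i. (i, j, v)" e i] ha by simp
  have c_pow: "h (c [^] e) (0, j, v) = (0, j + e, v)" for j v e
    using orbit[of c "\<lambda>j. (0, j, v)" e j] hc[of 0] P0 by simp
  have comm_shift_pow: "h (comm_shift i [^] j) (0, 0, v) = (0, j, P i j v)" for i j v
  proof -
    have "h (comm_shift i) (0, j, P i j v) = (0, j + 1, P i (j + 1) v)" for j
      by (simp only: comm_shift_def mult a_pow add_0 hc a int_pow_closed m_closed commutator_closed b) simp
    then show ?thesis
      using orbit[of "comm_shift i" "\<lambda>j. (0, j, P i j v)" j 0] P0 by simp
  qed
  have basis_elem_letter: "h (basis_elem x) (0, 0, v) = (0, 0, transvection l x 1 v)"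
    if x: "x \<in> basis_letters" for x v
  proof (cases x)
    case (Conj_b j)
    then show ?thesis
      by (simp only: basis_elem.simps mult c_pow hb a int_pow_closed m_closed commutator_closed b add_0) simp
  next
    case (Power_quot i j)
    then show ?thesis using P[of i j] x
      by (simp only: basis_elem.simps mult c_pow comm_shift_pow a int_pow_closed comm_shift_closed
          commutator_closed b) simp
  qed
  have basis_elem_pow: "h (basis_elem x [^] e) (0, 0, v) = (0, 0, transvection l x e v)"
    if x: "x \<in> basis_letters" for x e v
  proof -
    have "transvection l x 1 (transvection l x i v) = transvection l x (i + 1) v" for i
      using transvection_add[of l x] adj by (metis add.commute)
    then show ?thesis
      using orbit[of "basis_elem x" "\<lambda>i. (0, 0, transvection l x i v)" e 0] basis_elem_letter[OF x] by simp
  qed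
  have eval_closed: "syllable_eval G basis_elem w \<in> carrier G" if "fst ` set w \<subseteq> basis_letters" for w
    using that basis_elem_image_carrier by (rule syllable_eval_closed)
  have "h (syllable_eval G basis_elem w) (0, 0, v) = (0, 0, foldr (\<lambda>s. transvection l (fst s) (snd s)) w v)"
    using w
  proof (induction w)
    case Nil
    then show ?case by simp
  next
    case (Cons s w)
    then have "syllable_eval G basis_elem w \<in> carrier G" by (simp add: eval_closed)
    then have "h (syllable_eval G basis_elem (s # w)) (0, 0, v)
        = h (basis_elem (fst s) [^] snd s) (h (syllable_eval G basis_elem w) (0, 0, v))"
      by (simp only: syllable_eval.simps mult int_pow_closed basis_elem_closed)
    then show ?case using Cons basis_elem_pow by simp
  qed
  then show ?thesis
    by (simp only: mult a_pow c_pow a b int_pow_closed m_closed commutator_closed eval_closed[OF w]) simp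
qed

context group
begin

lemma word_eval_gen_word: "f x \<in> carrier G \<Longrightarrow> word_eval G f (gen_word x) = f x"
  by (simp add: gen_word_def)

lemma word_eval_inv:
  assumes f: "range f \<subseteq> carrier G"
  shows "word_eval G f (word_inv u) = inv word_eval G f u"
proof (induction u)
  case (Cons l u)
  obtain x s where l: "l = (x, s)" by fastforce
  have "f x \<in> carrier G" using f by auto
  then show ?case
    using word_eval_closed[OF f, of u] Cons
    by (cases s) (simp_all add: l word_inv_Cons word_eval_append[OF f] inv_mult_group)
qed (simp add: word_inv_Nil)

lemma word_eval_comm:
  assumes f: "range f \<subseteq> carrier G"
  shows "word_eval G f (word_comm u v) = commutator G (word_eval G f u) (word_eval G f v)"
  using word_eval_closed[OF f]
  by (simp add: word_comm_def commutator_def word_eval_append[OF f] word_eval_inv[OF f])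

lemma word_eval_pow:
  assumes f: "range f \<subseteq> carrier G"
  shows "word_eval G f (word_pow u k) = word_eval G f u [^] k"
proof (induction k)
  case (Suc k)
  have "word_eval G f (word_pow u (Suc k)) = word_eval G f u \<otimes> word_eval G f u [^] k"
    using Suc by (simp add: word_pow_def word_eval_append[OF f])
  then show ?case
    using word_eval_closed[OF f, of u] nat_pow_Suc2[of "word_eval G f u" k] by simp
qed (simp add: word_pow_def)

lemma commutator_eq_one_iff:
  assumes "x \<in> carrier G" "y \<in> carrier G"
  shows "commutator G x y = \<one> \<longleftrightarrow> x \<otimes> y = y \<otimes> x"
proof -
  have "commutator G x y = inv (y \<otimes> x) \<otimes> (x \<otimes> y)"
    using assms by (simp add: commutator_def inv_mult_group m_assoc)
  then show ?thesis
    using assms by (metis inv_closed inv_equality inv_inv l_inv m_closed)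
qed

end

lemma word_class_eq_word_eval:
  "word_class R u = word_eval (presented_group R) (\<lambda>x. word_class R (gen_word x)) u"
proof (induction u)
  case Nil
  show ?case by (simp add: one_presented_group)
next
  case (Cons l u)
  obtain x s where l: "l = (x, s)" by fastforce
  have "word_class R (l # u) = word_class R [l] \<otimes>\<^bsub>presented_group R\<^esub> word_class R u"
    by (simp add: mult_presented_group)
  also have "word_class R [l] =
      (if s then word_class R (gen_word x) else inv\<^bsub>presented_group R\<^esub> word_class R (gen_word x))"
    by (simp add: l gen_word_def inv_presented_group word_inv_def)
  finally show ?case using Cons by (simp add: l)
qed

theorem theorem4p1:
  fixes n :: nat and w :: "generator word" and G :: "generator word set monoid"
  assumes "n > 0"
    and "w = word_pow (word_comm word_a word_b) n"
    and "G = presented_group {word_comm word_a w}"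
  shows "residually_solvable G"
proof -
  let ?R = "{word_comm word_a w}"
  interpret G: group G unfolding assms(3) by (rule group_presented_group)
  define gen where "gen x = word_class ?R (gen_word x)" for x
  have gen: "range gen \<subseteq> carrier G" "gen x \<in> carrier G" for x
    by (auto simp: gen_def assms(3) carrier_presented_group)
  have eval: "word_class ?R u = word_eval G gen u" for u
    unfolding gen_def assms(3) by (rule word_class_eq_word_eval)
  have "word_eval G gen (word_comm word_a w) = \<one>\<^bsub>G\<^esub>"
    using word_eq.relator[of "word_comm word_a w" ?R "[]" "[]"]
    by (simp add: one_presented_group word_class_eq_iff flip: eval assms(3))
      (simp add: assms(3) one_presented_group word_class_eq_iff)
  then have rel: "commutator G (gen Gen_a) (commutator G (gen Gen_a) (gen Gen_b) [^]\<^bsub>G\<^esub> n) = \<one>\<^bsub>G\<^esub>"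
    by (simp add: assms(2) G.word_eval_comm[OF gen(1)] G.word_eval_pow[OF gen(1)]
        G.word_eval_gen_word gen(2))
  interpret commuting_commutator_power G "gen Gen_a" "gen Gen_b" n
    using rel by unfold_locales (simp_all add: gen(2) G.commutator_eq_one_iff)
  have all_normal: "g \<in> normal_forms" if "g \<in> carrier G" for g
  proof -
    have "g \<in> range (word_class ?R)"
      using that by (simp add: assms(3) carrier_presented_group)
    then obtain u where g: "g = word_eval G gen u"
      using eval by auto
    have "word_eval G gen u \<in> normal_forms"
    proof (induction u)
      case (Cons l u)
      show ?case
        using normal_forms_mult_left[OF Cons] by (cases "fst l") auto
    qed (simp add: one_normal_forms)
    then show ?thesis by (simp add: g)
  qed
  show ?thesis
  proof (rule residually_solvable_by_homs[OF G.is_group])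
    fix g assume "g \<in> carrier G" and g1: "g \<noteq> \<one>\<^bsub>G\<^esub>"
    then obtain p q :: int and u where u: "fst ` set u \<subseteq> basis_letters" "reduced u"
      and g: "g = gen Gen_a [^]\<^bsub>G\<^esub> p \<otimes>\<^bsub>G\<^esub> (c [^]\<^bsub>G\<^esub> q \<otimes>\<^bsub>G\<^esub> syllable_eval G basis_elem u)"
      by (meson all_normal normal_forms_cases)
    let ?l = "letter_at u" and ?m = "Suc (length u)"
    have adj: "?l (Suc k) \<noteq> Some x" if "?l k = Some x" for k x
      using u(2) that by (rule letter_at_adjacent)
    have tri: "transvection ?l x e \<in> triangular (\<lambda>k v. v k) ?m" for x e
      using adj by (rule transvection_triangular) (simp_all add: letter_at_def)
    \<comment> \<open>The identity is forced on level \<open>0\<close> and at multiples of \<open>n\<close>, where \<open>c ^ -j c\<^sub>i ^ j\<close> is trivial.\<close>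
    define P where "P i j = (if i = 0 \<or> j mod int n = 0 then id
      else transvection ?l (Power_quot i (j mod int n)) 1)" for i j
    have P_tri: "P i j \<in> triangular (\<lambda>k v. v k) ?m" for i j
      by (simp add: P_def tri id_triangular)
    have P_periodic: "P i (j + int n) = P i j" for i j
      by (simp add: P_def)
    let ?T = "triangular_group state_coord (?m + 2)"
    interpret T: group ?T by (rule group_triangular_group)
    obtain \<alpha> \<beta> where \<alpha>: "\<alpha> \<in> triangular state_coord (?m + 2)"
      and \<beta>: "\<beta> \<in> triangular state_coord (?m + 2)"
      and \<alpha>_apply: "\<And>i j v. \<alpha> (i, j, v) = (i + 1, j, v)"
      and \<beta>_apply: "\<And>j v. \<beta> (0, j, v) = (0, j, transvection ?l (Conj_b j) 1 v)"
      and \<gamma>_apply: "\<And>i j v. commutator ?T \<alpha> \<beta> (i, j, P i j v) = (i, j + 1, P i (j + 1) v)"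
      and comm: "\<alpha> \<circ> commutator ?T \<alpha> \<beta> [^]\<^bsub>?T\<^esub> n = commutator ?T \<alpha> \<beta> [^]\<^bsub>?T\<^esub> n \<circ> \<alpha>"
      using action_on_states[of "\<lambda>j. transvection ?l (Conj_b j) 1" ?m P n, OF tri P_tri P_periodic]
      by metis
    define f where "f = case_generator \<alpha> \<beta>"
    have f: "range f \<subseteq> carrier ?T"
      using \<alpha> \<beta> by (auto simp: f_def split: generator.split)
    have f_gen: "word_eval ?T f word_a = \<alpha>" "word_eval ?T f word_b = \<beta>"
      by (simp_all add: gen_word_def f_def)
    have "word_eval ?T f r = \<one>\<^bsub>?T\<^esub>" if "r \<in> ?R" for r
    proof -
      have "\<alpha> \<in> carrier ?T" "\<beta> \<in> carrier ?T" using \<alpha> \<beta> by simp_all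
      then have "commutator ?T \<alpha> (commutator ?T \<alpha> \<beta> [^]\<^bsub>?T\<^esub> n) = \<one>\<^bsub>?T\<^esub>"
        using comm by (subst T.commutator_eq_one_iff)
            (simp_all only: T.nat_pow_closed T.commutator_closed triangular_group_simps(2))
      then show ?thesis
        using that
        by (simp only: singleton_iff assms(2) T.word_eval_comm[OF f] T.word_eval_pow[OF f] f_gen)
    qed
    then obtain h where h: "h \<in> hom G ?T" and h_eval: "\<And>u. h (word_class ?R u) = word_eval ?T f u"
      using T.presented_group_universal[OF f, of ?R] assms(3) by blast
    have h_gen: "h (gen Gen_a) = \<alpha>" "h (gen Gen_b) = \<beta>"
      by (simp_all only: gen_def h_eval f_gen)
    have "group_hom G ?T h"
      using h by (simp add: group_hom_def group_hom_axioms_def G.is_group group_triangular_group)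
    then have h_c: "h c = commutator ?T \<alpha> \<beta>"
      by (simp only: group_hom.hom_commutator gen(2) h_gen)
    define v :: "nat \<Rightarrow> int" where "v k = (if k = 0 then 1 else 0)" for k
    have image: "h g (0, 0, v) = (p, q, foldr (\<lambda>s. transvection ?l (fst s) (snd s)) u v)"
      unfolding g
    proof (rule hom_normal_form[OF h])
      show "h (gen Gen_a) (i, j, v) = (i + 1, j, v)" for i j v
        by (simp only: h_gen \<alpha>_apply)
      show "h (gen Gen_b) (0, j, v) = (0, j, transvection ?l (Conj_b j) 1 v)" for j v
        by (simp only: h_gen \<beta>_apply)
      show "h c (i, j, P i j v) = (i, j + 1, P i (j + 1) v)" for i j v
        by (simp only: h_c \<gamma>_apply)
      show "P i j = transvection ?l (Power_quot i j) 1" if "Power_quot i j \<in> basis_letters" for i j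
        using that by (auto simp: P_def basis_letters_def)
      show "?l (Suc k) \<noteq> Some x" if "?l k = Some x" for k x
        using that by (rule adj)
      show "P 0 j = id" "P i 0 = id" for i j
        by (simp_all add: P_def)
    qed (rule u(1))
    have detect: "foldr (\<lambda>s. transvection ?l (fst s) (snd s)) u v (length u) \<noteq> 0"
      using transvections_detect[of u ?l v] u(2) by (simp add: letter_at_def reduced_def v_def)
    have "h g \<noteq> \<one>\<^bsub>?T\<^esub>"
    proof
      assume "h g = \<one>\<^bsub>?T\<^esub>"
      then have "p = 0" "q = 0" "foldr (\<lambda>s. transvection ?l (fst s) (snd s)) u v = v"
        using image by simp_all
      moreover from this have "u = []" using detect by (simp add: v_def split: if_splits)
      ultimately show False using g g1 by simp
    qed
    then show "\<exists>(S :: (state \<Rightarrow> state) monoid) \<phi>. group S \<and> solvable S \<and> \<phi> \<in> hom G S \<and> \<phi> g \<noteq> \<one>\<^bsub>S\<^esub>"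
      using h T.is_group solvable_triangular_group[of state_coord, OF state_coord_inj] by blast
  qed
qed

end
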